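(* Let $G$ be a connected graph that does not contain a fat $TK_{\aleph_0}$ as a subgraph. Then $G$ has a normal spanning tree.
   Context: Graphs are simple, undirected and of arbitrary (possibly infinite) cardinality. Tree order: for a graph-theoretic tree $T$ with root $r$, write $x\le y$ for vertices $x,y$ of $T$ if $x$ lies on the unique path in $T$ from $r$ to $y$. A rooted spanning tree $T$ of a graph $G$ is normal if the two ends of every edge of $G$ are comparable in the tree order of $T$; such a $T$ is called a normal spanning tree of $G$. A fat $K^{\aleph_0}$ is the multigraph obtained from the complete graph on countably infinitely many vertices by replacing every edge by uncountably many parallel edges. A fat $TK_{\aleph_0}$ is a subdivision of a fat $K^{\aleph_0}$, i.e. a graph obtained from it by replacing its edges by paths between their ends, where the paths have pairwise disjoint interiors that also avoid the original (branch) vertices. *)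

theory Defs
  imports Main "HOL-Library.Countable_Set"
begin

record 'a graph =
  verts :: "'a set"
  edges :: "'a set set"

definition simple_graph :: "'a graph \<Rightarrow> bool" where
  "simple_graph G \<longleftrightarrow>
     (\<forall>e\<in>edges G. \<exists>u v. u \<in> verts G \<and> v \<in> verts G \<and> u \<noteq> v \<and> e = {u, v})"

definition subgraph :: "'a graph \<Rightarrow> 'a graph \<Rightarrow> bool" where
  "subgraph H G \<longleftrightarrow> simple_graph H \<and> verts H \<subseteq> verts G \<and> edges H \<subseteq> edges G"

text \<open>A path is given by the list of its vertices; a one-element list is a trivial path.\<close>

definition path_edges :: "'a list \<Rightarrow> 'a set set" where
  "path_edges xs = {{xs ! i, xs ! Suc i} | i. Suc i < length xs}"

definition path_interior :: "'a list \<Rightarrow> 'a set" where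
  "path_interior xs = set xs - {hd xs, last xs}"

definition is_path :: "'a graph \<Rightarrow> 'a list \<Rightarrow> bool" where
  "is_path G xs \<longleftrightarrow>
     xs \<noteq> [] \<and> distinct xs \<and> set xs \<subseteq> verts G \<and> path_edges xs \<subseteq> edges G"

definition is_path_between :: "'a graph \<Rightarrow> 'a \<Rightarrow> 'a list \<Rightarrow> 'a \<Rightarrow> bool" where
  "is_path_between G u xs v \<longleftrightarrow> is_path G xs \<and> hd xs = u \<and> last xs = v"

definition is_cycle :: "'a graph \<Rightarrow> 'a list \<Rightarrow> bool" where
  "is_cycle G xs \<longleftrightarrow> is_path G xs \<and> length xs \<ge> 3 \<and> {last xs, hd xs} \<in> edges G"

text \<open>The empty graph does not count as connected (it has no rooted spanning tree).\<close>

definition connected_graph :: "'a graph \<Rightarrow> bool" where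
  "connected_graph G \<longleftrightarrow>
     verts G \<noteq> {} \<and> (\<forall>u\<in>verts G. \<forall>v\<in>verts G. \<exists>xs. is_path_between G u xs v)"

definition is_tree :: "'a graph \<Rightarrow> bool" where
  "is_tree T \<longleftrightarrow> simple_graph T \<and> connected_graph T \<and> (\<nexists>xs. is_cycle T xs)"

text \<open>Used only when \<open>T\<close> is a tree and \<open>r\<close>, \<open>y\<close> are vertices of it, so that the path
  is unique.\<close>

definition tree_le :: "'a graph \<Rightarrow> 'a \<Rightarrow> 'a \<Rightarrow> 'a \<Rightarrow> bool" where
  "tree_le T r x y \<longleftrightarrow> (\<exists>xs. is_path_between T r xs y \<and> x \<in> set xs)"

definition spanning_tree :: "'a graph \<Rightarrow> 'a graph \<Rightarrow> bool" where
  "spanning_tree G T \<longleftrightarrow> is_tree T \<and> subgraph T G \<and> verts T = verts G"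

definition normal_spanning_tree :: "'a graph \<Rightarrow> 'a graph \<Rightarrow> 'a \<Rightarrow> bool" where
  "normal_spanning_tree G T r \<longleftrightarrow>
     spanning_tree G T \<and> r \<in> verts T \<and>
     (\<forall>u v. {u, v} \<in> edges G \<longrightarrow> tree_le T r u v \<or> tree_le T r v u)"

record ('v, 'e) multigraph =
  mverts :: "'v set"
  medges :: "'e set"
  mends :: "'e \<Rightarrow> 'v set"

definition loopless_multigraph :: "('v, 'e) multigraph \<Rightarrow> bool" where
  "loopless_multigraph M \<longleftrightarrow>
     (\<forall>e\<in>medges M. \<exists>u v. u \<in> mverts M \<and> v \<in> mverts M \<and> u \<noteq> v \<and> mends M e = {u, v})"

definition fat_K_aleph0 :: "('v, 'e) multigraph \<Rightarrow> bool" where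
  "fat_K_aleph0 M \<longleftrightarrow>
     loopless_multigraph M \<and> countable (mverts M) \<and> infinite (mverts M) \<and>
     (\<forall>u\<in>mverts M. \<forall>v\<in>mverts M. u \<noteq> v \<longrightarrow> uncountable {e \<in> medges M. mends M e = {u, v}})"

text \<open>\<open>H\<close> is a subdivision of the loopless multigraph \<open>M\<close>: \<open>f\<close> maps the vertices of \<open>M\<close>
  to the branch vertices and \<open>p\<close> maps each edge to the path replacing it. Disjointness of
  the edge sets prevents two parallel edges of \<open>M\<close> from being replaced by one and the same
  edge of \<open>H\<close>, whose interior is empty; in all other cases it follows from the conditions
  on the interiors.\<close>

definition subdivision :: "('v, 'e) multigraph \<Rightarrow> 'a graph \<Rightarrow> bool" where
  "subdivision M H \<longleftrightarrow>
     (\<exists>(f :: 'v \<Rightarrow> 'a) (p :: 'e \<Rightarrow> 'a list).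
        inj_on f (mverts M) \<and>
        (\<forall>e\<in>medges M. is_path H (p e) \<and> {hd (p e), last (p e)} = f ` mends M e \<and>
           path_interior (p e) \<inter> f ` mverts M = {}) \<and>
        (\<forall>e\<in>medges M. \<forall>e'\<in>medges M. e \<noteq> e' \<longrightarrow>
           path_interior (p e) \<inter> path_interior (p e') = {} \<and>
           path_edges (p e) \<inter> path_edges (p e') = {}) \<and>
        verts H = f ` mverts M \<union> (\<Union>e\<in>medges M. set (p e)) \<and>
        edges H = (\<Union>e\<in>medges M. path_edges (p e)))"

text \<open>HOL cannot quantify over the vertex and edge types of \<open>M\<close>. The types chosen lose no
  generality: in a subdivision of a fat \<open>K\<close>, vertices of \<open>M\<close> correspond injectively
  to branch vertices and edges of \<open>M\<close> to the paths replacing them, so \<open>M\<close> may be relabelled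
  by these.\<close>

definition fat_TK_aleph0 :: "'a graph \<Rightarrow> bool" where
  "fat_TK_aleph0 H \<longleftrightarrow> (\<exists>M :: ('a, 'a list) multigraph. fat_K_aleph0 M \<and> subdivision M H)"

end

theory Submission imports Defs "HOL-Library.Nat_Bijection"
begin

text \<open>
  The root paths of all vertices are built simultaneously, in countably many steps. At every
  step the vertices not yet reached fall into connected regions, and each region \<open>D\<close> carries a
  finite path from the root, its trunk (empty at the start), which contains all neighbours of
  \<open>D\<close> and ends in one of them. A step prolongs the trunk by a path
  inside \<open>D\<close>, the branch, whose vertices are thereby reached. What is left of \<open>D\<close> splits into components; for each of them the prolonged trunk is
  cut back to its last vertex that is adjacent to the component. Since a reached vertex with a
  neighbour in a region stays on the trunk of that region, adjacent vertices become comparable.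
  Hence, if every vertex is reached after finitely many steps, the root paths form a normal
  spanning tree (\<open>normal_spanning_tree_if_all_hit\<close>).

  Which vertices are reached depends on the choice of the branches. Call two vertices
  uncountably linked if no countable set meets the interiors of all paths between them that have
  an interior vertex, and fix a countable separator for every pair that is not so linked. At step \<open>n\<close>,
  which codes a triple \<open>(i, j, k)\<close>, the branch of a region is made to contain the \<open>k\<close>-th vertex
  of the separator of the \<open>i\<close>-th and the \<open>j\<close>-th trunk vertex whenever this vertex lies in the
  region. Every triple has infinitely many turns.

  Suppose that \<open>v\<close> is never reached. The regions around \<open>v\<close> decrease; let \<open>C\<close> be the
  component of \<open>v\<close> in their intersection. If \<open>C\<close> had only finitely many neighbours, then all of them
  would be reached at some finite step, so \<open>C\<close> would be a region, and the next branch would run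
  through it. So \<open>C\<close> has infinitely many neighbours, and every one of them eventually has a fixed
  position on the trunks (\<open>limit_neighbourhood\<close>). Any two of them are joined by a path
  through \<open>C\<close>. A separator of the two would therefore contain a vertex of \<open>C\<close>, and this vertex
  would be reached when its turn comes, which is impossible.
  So the neighbours of \<open>C\<close> are pairwise uncountably linked (\<open>limit_neighbours_linked\<close>), and infinitely many such vertices are the branch vertices
  of a fat \<open>TK\<close> (\<open>fat_TK_if_pairwise_uncountably_linked\<close>).
\<close>

section \<open>Paths, connected vertex sets and their neighbourhoods\<close>

lemma path_edges_simps [simp]:
  "path_edges [] = {}" "path_edges [x] = {}"
  "path_edges (x # y # zs) = insert {x, y} (path_edges (y # zs))"
proof -
  show "path_edges [] = {}" "path_edges [x] = {}"
    by (auto simp: path_edges_def)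
  show "path_edges (x # y # zs) = insert {x, y} (path_edges (y # zs))" (is "?L = ?R")
  proof (rule subset_antisym; rule subsetI)
    fix e assume "e \<in> ?L"
    then obtain i where i: "Suc i < length (x # y # zs)"
      "e = {(x # y # zs) ! i, (x # y # zs) ! Suc i}"
      unfolding path_edges_def by blast
    then show "e \<in> ?R"
      by (cases i) (auto simp: path_edges_def)
  next
    fix e assume "e \<in> ?R"
    then consider "e = {x, y}" | i where "Suc i < length (y # zs)" "e = {(y # zs) ! i, (y # zs) ! Suc i}"
      unfolding path_edges_def by blast
    then show "e \<in> ?L"
    proof cases
      case 1
      then show ?thesis
        unfolding path_edges_def by (intro CollectI exI[of _ 0]) simp
    next
      case (2 i)
      then show ?thesis
        unfolding path_edges_def by (intro CollectI exI[of _ "Suc i"]) simp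
    qed
  qed
qed

lemma path_edges_append:
  "path_edges (xs @ ys) =
     path_edges xs \<union> path_edges ys \<union> (if xs = [] \<or> ys = [] then {} else {{last xs, hd ys}})"
proof (induction xs)
  case (Cons x xs)
  show ?case
  proof (cases xs)
    case Nil
    then show ?thesis by (cases ys) auto
  next
    case (Cons x' xs')
    then show ?thesis using Cons.IH by auto
  qed
qed simp

lemma path_edges_subset: "e \<in> path_edges xs \<Longrightarrow> e \<subseteq> set xs"
  by (auto simp: path_edges_def)

definition adj_in :: "'a graph \<Rightarrow> 'a set \<Rightarrow> ('a \<times> 'a) set" where
  "adj_in G A = {(a, b). a \<in> A \<and> b \<in> A \<and> {a, b} \<in> edges G}"

definition component :: "'a graph \<Rightarrow> 'a set \<Rightarrow> 'a \<Rightarrow> 'a set" where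
  "component G A v = {w. v \<in> A \<and> (v, w) \<in> (adj_in G A)\<^sup>*}"

definition connected_in :: "'a graph \<Rightarrow> 'a set \<Rightarrow> bool" where
  "connected_in G A \<longleftrightarrow> (\<forall>a\<in>A. \<forall>b\<in>A. (a, b) \<in> (adj_in G A)\<^sup>*)"

definition nbh :: "'a graph \<Rightarrow> 'a set \<Rightarrow> 'a set" where
  "nbh G A = {u \<in> verts G - A. \<exists>d\<in>A. {u, d} \<in> edges G}"

lemma adj_in_sym: "(a, b) \<in> (adj_in G A)\<^sup>* \<Longrightarrow> (b, a) \<in> (adj_in G A)\<^sup>*"
proof -
  have "sym (adj_in G A)"
    by (auto simp: sym_def adj_in_def insert_commute)
  then show "(a, b) \<in> (adj_in G A)\<^sup>* \<Longrightarrow> (b, a) \<in> (adj_in G A)\<^sup>*"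
    by (meson sym_rtrancl symD)
qed

lemma component_subset: "component G A v \<subseteq> A"
proof
  fix w assume "w \<in> component G A v"
  then have "v \<in> A" "(v, w) \<in> (adj_in G A)\<^sup>*"
    by (auto simp: component_def)
  from this(2,1) show "w \<in> A"
    by (induction) (auto simp: adj_in_def)
qed

lemma component_self: "v \<in> A \<Longrightarrow> v \<in> component G A v"
  by (simp add: component_def)

lemma component_eq: "w \<in> component G A v \<Longrightarrow> component G A w = component G A v"
proof -
  assume w: "w \<in> component G A v"
  then have "w \<in> A" using component_subset by fast
  moreover have "(v, w) \<in> (adj_in G A)\<^sup>*" "(w, v) \<in> (adj_in G A)\<^sup>*" "v \<in> A"
    using w by (simp_all add: component_def adj_in_sym)
  ultimately show ?thesis
    unfolding component_def by (metis rtrancl_trans)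
qed

lemma component_closed:
  "u \<in> component G A v \<Longrightarrow> w \<in> A \<Longrightarrow> {u, w} \<in> edges G \<Longrightarrow> w \<in> component G A v"
proof -
  assume u: "u \<in> component G A v" and w: "w \<in> A" "{u, w} \<in> edges G"
  have "u \<in> A" using u component_subset by fast
  then have "(u, w) \<in> adj_in G A" using w by (simp add: adj_in_def)
  then show ?thesis using u by (auto simp: component_def intro: rtrancl_into_rtrancl)
qed

lemma component_connected: "connected_in G (component G A v)"
proof -
  let ?C = "component G A v"
  have *: "(v, w) \<in> (adj_in G ?C)\<^sup>*" if "(v, w) \<in> (adj_in G A)\<^sup>*" "v \<in> A" for w
    using that
  proof (induction)
    case (step y z)
    have "y \<in> ?C" "z \<in> ?C"
      using step by (auto simp: component_def)
    then have "(y, z) \<in> adj_in G ?C"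
      using step.hyps(2) by (simp add: adj_in_def)
    then show ?case using step by (simp add: rtrancl_into_rtrancl)
  qed simp
  show ?thesis
    unfolding connected_in_def
  proof (intro ballI)
    fix a b assume "a \<in> ?C" "b \<in> ?C"
    then have "(v, a) \<in> (adj_in G ?C)\<^sup>*" "(v, b) \<in> (adj_in G ?C)\<^sup>*"
      using * unfolding component_def by simp_all
    then show "(a, b) \<in> (adj_in G ?C)\<^sup>*"
      by (rule rtrancl_trans[OF adj_in_sym])
  qed
qed

text \<open>A path in \<open>D\<close> that starts in \<open>C\<close> would leave \<open>C\<close> through a neighbour of \<open>C\<close>.\<close>

lemma connected_in_no_boundary:
  assumes "connected_in G D" "D \<subseteq> verts G" "C \<subseteq> D" "C \<noteq> {}" "nbh G C \<inter> D = {}"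
  shows "C = D"
proof -
  obtain c where c: "c \<in> C" using assms by blast
  have "d \<in> C" if "d \<in> D" for d
  proof -
    have "(c, d) \<in> (adj_in G D)\<^sup>*"
      using assms c that by (auto simp: connected_in_def)
    then show ?thesis using c
    proof (induction)
      case (step y z)
      then have "y \<in> C" "z \<in> D" "{z, y} \<in> edges G"
        by (auto simp: adj_in_def insert_commute)
      then show ?case using assms(2,5) by (auto simp: nbh_def)
    qed
  qed
  then show ?thesis using assms by blast
qed

lemma connected_in_path:
  assumes "connected_in G A" "A \<subseteq> verts G" "a \<in> A" "b \<in> A"
  obtains xs where "is_path_between G a xs b" "set xs \<subseteq> A"
proof -
  have "(a, b) \<in> (adj_in G A)\<^sup>*"
    using assms by (auto simp: connected_in_def)
  then have "\<exists>xs. is_path_between G a xs b \<and> set xs \<subseteq> A"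
  proof (induction)
    case base
    have "is_path_between G a [a] a" "set [a] \<subseteq> A"
      using assms by (auto simp: is_path_between_def is_path_def)
    then show ?case by blast
  next
    case (step y z)
    then obtain xs where xs: "is_path_between G a xs y" "set xs \<subseteq> A" by blast
    have z: "z \<in> A" "{y, z} \<in> edges G"
      using step by (auto simp: adj_in_def)
    show ?case
    proof (cases "z \<in> set xs")
      case True
      then obtain ys zs where s: "xs = ys @ z # zs" by (meson split_list)
      have e: "xs = (ys @ [z]) @ zs" using s by simp
      have "path_edges (ys @ [z]) \<subseteq> path_edges xs"
        unfolding e path_edges_append[of "ys @ [z]" zs] by blast
      moreover have "hd xs = hd (ys @ [z])" "set (ys @ [z]) \<subseteq> set xs"
        "distinct xs \<Longrightarrow> distinct (ys @ [z])"
        unfolding e by (cases ys; auto)+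
      ultimately have "is_path_between G a (ys @ [z]) z" "set (ys @ [z]) \<subseteq> A"
        using xs order_trans unfolding is_path_between_def is_path_def
        by (metis last_snoc snoc_eq_iff_butlast, metis)
      then show ?thesis by blast
    next
      case False
      then have "is_path_between G a (xs @ [z]) z" "set (xs @ [z]) \<subseteq> A"
        using xs z assms(2) unfolding is_path_between_def is_path_def path_edges_append by auto
      then show ?thesis by blast
    qed
  qed
  then show ?thesis using that by blast
qed

lemma path_reachable:
  "xs \<noteq> [] \<Longrightarrow> set xs \<subseteq> A \<Longrightarrow> path_edges xs \<subseteq> edges G \<Longrightarrow> (hd xs, last xs) \<in> (adj_in G A)\<^sup>*"
proof (induction xs)
  case (Cons x xs)
  show ?case
  proof (cases xs)
    case (Cons y ys)
    then have "(x, y) \<in> adj_in G A" "(y, last xs) \<in> (adj_in G A)\<^sup>*"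
      using Cons.prems Cons.IH by (auto simp: adj_in_def)
    then show ?thesis using Cons by (simp add: converse_rtrancl_into_rtrancl)
  qed simp
qed simp

lemma connected_graph_connected_in: "connected_graph G \<Longrightarrow> connected_in G (verts G)"
  unfolding connected_in_def
proof (intro ballI)
  fix a b assume "connected_graph G" "a \<in> verts G" "b \<in> verts G"
  then obtain xs where "is_path_between G a xs b"
    by (auto simp: connected_graph_def)
  then show "(a, b) \<in> (adj_in G (verts G))\<^sup>*"
    using path_reachable[of xs "verts G" G] unfolding is_path_between_def is_path_def by blast
qed

section \<open>Normal spanning trees from root paths\<close>

text \<open>The tree is the union of the paths. Prefix-closure makes the two ends of every tree edge
  differ in exactly one final step of their root paths, so that each vertex has at most one neighbour
  with a shorter root path; this excludes cycles.\<close>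

lemma normal_spanning_tree_of_root_paths:
  fixes G :: "'a graph" and \<pi> :: "'a \<Rightarrow> 'a list"
  assumes simple: "simple_graph G" and r: "r \<in> verts G"
    and path: "\<And>v. v \<in> verts G \<Longrightarrow> is_path_between G r (\<pi> v) v"
    and pref: "\<And>v w ys zs. v \<in> verts G \<Longrightarrow> \<pi> v = ys @ w # zs \<Longrightarrow> \<pi> w = ys @ [w]"
    and comparable: "\<And>u v. {u, v} \<in> edges G \<Longrightarrow> u \<in> set (\<pi> v) \<or> v \<in> set (\<pi> u)"
  shows "\<exists>T. normal_spanning_tree G T r"
proof -
  define T where "T = \<lparr>verts = verts G, edges = (\<Union>v\<in>verts G. path_edges (\<pi> v))\<rparr>"
  have vT: "verts T = verts G" and eT: "edges T = (\<Union>v\<in>verts G. path_edges (\<pi> v))"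
    by (auto simp: T_def)
  have eTG: "edges T \<subseteq> edges G"
    using path unfolding eT is_path_between_def is_path_def by blast
  have sT: "simple_graph T"
    using simple eTG unfolding simple_graph_def vT by (meson subsetD)
  have pT: "is_path_between T r (\<pi> v) v" if "v \<in> verts G" for v
    using path[OF that] that unfolding is_path_between_def is_path_def vT eT by blast
  have conn: "connected_graph T"
  proof -
    have "connected_in T (verts T)"
      unfolding connected_in_def
    proof (intro ballI)
      fix a b assume ab: "a \<in> verts T" "b \<in> verts T"
      have "(r, v) \<in> (adj_in T (verts T))\<^sup>*" if "v \<in> verts T" for v
        using pT[of v] that path_reachable[of "\<pi> v" "verts T" T]
        unfolding is_path_between_def is_path_def vT by metis
      then show "(a, b) \<in> (adj_in T (verts T))\<^sup>*"
        using ab by (meson adj_in_sym rtrancl_trans)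
    qed
    then show ?thesis
      unfolding connected_graph_def using r vT connected_in_path[OF _ order_refl] by (metis empty_iff)
  qed
  have edge: "\<pi> b = \<pi> a @ [b] \<or> \<pi> a = \<pi> b @ [a]" if ab: "{a, b} \<in> edges T" for a b
  proof -
    obtain v where v: "v \<in> verts G" "{a, b} \<in> path_edges (\<pi> v)"
      using ab unfolding eT by blast
    then obtain i where i: "Suc i < length (\<pi> v)" "{a, b} = {\<pi> v ! i, \<pi> v ! Suc i}"
      by (auto simp: path_edges_def)
    let ?x = "\<pi> v ! i" and ?y = "\<pi> v ! Suc i"
    have "\<pi> v = take i (\<pi> v) @ ?x # drop (Suc i) (\<pi> v)"
      by (rule id_take_nth_drop) (use i in simp)
    then have x: "\<pi> ?x = take i (\<pi> v) @ [?x]" by (rule pref[OF v(1)])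
    have "\<pi> v = take (Suc i) (\<pi> v) @ ?y # drop (Suc (Suc i)) (\<pi> v)"
      by (rule id_take_nth_drop) (use i in simp)
    then have "\<pi> ?y = take (Suc i) (\<pi> v) @ [?y]" by (rule pref[OF v(1)])
    then have "\<pi> ?y = \<pi> ?x @ [?y]"
      using x i by (simp add: take_Suc_conv_app_nth)
    moreover have "a = ?x \<and> b = ?y \<or> a = ?y \<and> b = ?x"
      using i(2) by (auto simp: doubleton_eq_iff)
    ultimately show ?thesis by auto
  qed
  have acyc: "\<nexists>xs. is_cycle T xs"
  proof
    assume "\<exists>xs. is_cycle T xs"
    then obtain xs where xs: "is_path T xs" "length xs \<ge> 3" "{last xs, hd xs} \<in> edges T"
      by (auto simp: is_cycle_def)
    let ?n = "length xs"
    have d: "distinct xs" and vs: "set xs \<subseteq> verts G" and es: "path_edges xs \<subseteq> edges T"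
      using xs by (auto simp: is_path_def vT)
    \<comment> \<open>A vertex of the cycle that is highest in the tree has both its neighbours as parents.\<close>
    have "Max (length ` \<pi> ` set xs) \<in> length ` \<pi> ` set xs"
      using xs(2) by (intro Max_in) auto
    then obtain x where "x \<in> set xs" "length (\<pi> x) = Max (length ` \<pi> ` set xs)"
      by fastforce
    then have x: "x \<in> set xs" "\<And>y. y \<in> set xs \<Longrightarrow> length (\<pi> y) \<le> length (\<pi> x)"
      by auto
    have eq: "y = z" if "y \<in> set xs" "z \<in> set xs" "{x, y} \<in> edges T" "{x, z} \<in> edges T" for y z
    proof -
      have "\<pi> x = \<pi> y @ [x]" "\<pi> x = \<pi> z @ [x]"
        using edge[OF that(3)] x(2)[OF that(1)] edge[OF that(4)] x(2)[OF that(2)] by (elim disjE; simp)+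
      then have "\<pi> y = \<pi> z" by simp
      then show ?thesis
        using path[of y] path[of z] that vs by (auto simp: is_path_between_def)
    qed
    obtain i where i: "i < ?n" "xs ! i = x" using x(1) by (meson in_set_conv_nth)
    define j where "j = (if Suc i = ?n then 0 else Suc i)"
    define k where "k = (if i = 0 then ?n - 1 else i - 1)"
    have jk: "j < ?n" "k < ?n" "j \<noteq> k"
      using i xs(2) by (auto simp: j_def k_def)
    have step: "{xs ! m, xs ! Suc m} \<in> edges T" if "Suc m < ?n" for m
      using es that by (auto simp: path_edges_def)
    have wrap: "{xs ! (?n - 1), xs ! 0} \<in> edges T"
      using xs(2,3) last_conv_nth[of xs] hd_conv_nth[of xs] by (cases "xs = []") simp_all
    have "{x, xs ! j} \<in> edges T"
    proof (cases "Suc i = ?n")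
      case True
      then have "i = ?n - 1" by simp
      then show ?thesis using i(2) wrap True by (simp add: j_def)
    qed (use i step[of i] in \<open>simp add: j_def\<close>)
    moreover have "{x, xs ! k} \<in> edges T"
      using i wrap step[of "i - 1"] by (cases i) (simp_all add: k_def insert_commute)
    ultimately have "xs ! j = xs ! k" using eq jk by simp
    then show False using jk d by (simp add: nth_eq_iff_index_eq)
  qed
  have "tree_le T r u v \<or> tree_le T r v u" if "{u, v} \<in> edges G" for u v
  proof -
    have "u \<in> verts G" "v \<in> verts G"
      using simple that unfolding simple_graph_def by (fastforce simp: doubleton_eq_iff)+
    then show ?thesis
      using comparable[OF that] pT unfolding tree_le_def by blast
  qed
  then have "normal_spanning_tree G T r"
    unfolding normal_spanning_tree_def spanning_tree_def is_tree_def subgraph_def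
    using sT conn acyc eTG r vT by blast
  then show ?thesis by blast
qed


section \<open>The branching process\<close>

text \<open>The situation \<open>p\<close>, \<open>D\<close> of a trunk and its region before a step; the trunk is empty only
  at the start, when the region is the whole graph.\<close>

definition extendable :: "'a graph \<Rightarrow> 'a list \<Rightarrow> 'a set \<Rightarrow> bool" where
  "extendable G p D \<longleftrightarrow>
     D \<noteq> {} \<and> D \<subseteq> verts G \<and> connected_in G D \<and> (p \<noteq> [] \<longrightarrow> last p \<in> nbh G D)"

definition extension :: "'a graph \<Rightarrow> 'a list \<Rightarrow> 'a set \<Rightarrow> 'a list \<Rightarrow> bool" where
  "extension G p D q \<longleftrightarrow>
     is_path G q \<and> set q \<subseteq> D \<and> (p \<noteq> [] \<longrightarrow> {last p, hd q} \<in> edges G)"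

text \<open>Cutting back to the last vertex adjacent to \<open>D\<close>, rather than keeping the whole list, is what
  allows the next branch to be attached at the end of the trunk by an edge of \<open>G\<close>.\<close>

definition trim :: "'a graph \<Rightarrow> 'a set \<Rightarrow> 'a list \<Rightarrow> 'a list" where
  "trim G D xs = rev (dropWhile (\<lambda>x. x \<notin> nbh G D) (rev xs))"

lemma extension_exists:
  assumes "extendable G p D"
  shows "\<exists>q. extension G p D q \<and> (t \<in> D \<longrightarrow> t \<in> set q)"
proof -
  have D: "D \<noteq> {}" "D \<subseteq> verts G" "connected_in G D" and l: "p \<noteq> [] \<Longrightarrow> last p \<in> nbh G D"
    using assms by (auto simp: extendable_def)
  have "\<exists>d\<in>D. p \<noteq> [] \<longrightarrow> {last p, d} \<in> edges G"
    using l D(1) by (cases "p = []") (auto simp: nbh_def)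
  then obtain d where d: "d \<in> D" "p \<noteq> [] \<longrightarrow> {last p, d} \<in> edges G" by blast
  define s where "s = (if t \<in> D then t else d)"
  have "s \<in> D" using d by (simp add: s_def)
  then obtain q where q: "is_path_between G d q s" "set q \<subseteq> D"
    using connected_in_path[OF D(3,2) d(1)] by blast
  then have qs: "is_path G q" "hd q = d" "last q = s" "q \<noteq> []"
    by (auto simp: is_path_between_def is_path_def)
  then have "s \<in> set q" by (metis last_in_set)
  then show ?thesis
    using q qs d(2) by (auto simp: extension_def s_def intro!: exI[of _ q])
qed

lemma trim_prefix: "\<exists>zs. xs = trim G D xs @ zs \<and> set zs \<inter> nbh G D = {}"
proof (intro exI conjI)
  let ?P = "\<lambda>x. x \<notin> nbh G D"
  show "xs = trim G D xs @ rev (takeWhile ?P (rev xs))"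
    unfolding trim_def rev_append[symmetric] takeWhile_dropWhile_id by simp
  show "set (rev (takeWhile ?P (rev xs))) \<inter> nbh G D = {}"
    using set_takeWhileD by fastforce
qed

lemma trim_last: "trim G D xs \<noteq> [] \<Longrightarrow> last (trim G D xs) \<in> nbh G D"
  using hd_dropWhile[of "\<lambda>x. x \<notin> nbh G D" "rev xs"] by (simp add: trim_def last_rev)

lemma nbh_component_diff:
  assumes "Q \<subseteq> D"
  shows "nbh G (component G (D - Q) v) \<subseteq> nbh G D \<union> Q"
proof
  fix u assume u: "u \<in> nbh G (component G (D - Q) v)"
  then obtain d where d: "d \<in> component G (D - Q) v" "{u, d} \<in> edges G" "u \<in> verts G"
    "u \<notin> component G (D - Q) v"
    by (auto simp: nbh_def)
  have "d \<in> D" using d(1) component_subset by fastforce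
  have "u \<notin> D - Q"
    using component_closed[OF d(1), of u] d by (auto simp: insert_commute)
  then show "u \<in> nbh G D \<union> Q"
    using d \<open>d \<in> D\<close> by (auto simp: nbh_def)
qed

text \<open>The strategy \<open>ext\<close> sees the step number, the trunk and the region, but not the vertex whose
  path is sought; hence the vertices of one region move together.\<close>

locale branching =
  fixes G :: "'a graph" and ext :: "nat \<Rightarrow> 'a list \<Rightarrow> 'a set \<Rightarrow> 'a list"
  assumes simple: "simple_graph G" and conn: "connected_graph G"
    and ext: "extendable G p D \<Longrightarrow> extension G p D (ext n p D)"
begin

text \<open>Once \<open>v\<close> lies on a branch, its region is empty from the next step on, because
  \<open>component G A v\<close> is empty for \<open>v \<notin> A\<close>; the trunks of these later steps have no meaning.\<close>

primrec state :: "nat \<Rightarrow> 'a \<Rightarrow> 'a list \<times> 'a set" where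
  "state 0 v = ([], verts G)"
| "state (Suc n) v =
     (let (p, D) = state n v; q = ext n p D; D' = component G (D - set q) v
      in (trim G D' (p @ q), D'))"

definition trunk :: "nat \<Rightarrow> 'a \<Rightarrow> 'a list" where "trunk n v = fst (state n v)"
definition region :: "nat \<Rightarrow> 'a \<Rightarrow> 'a set" where "region n v = snd (state n v)"
definition branch :: "nat \<Rightarrow> 'a \<Rightarrow> 'a list" where "branch n v = ext n (trunk n v) (region n v)"

lemma region_0 [simp]: "region 0 v = verts G" and trunk_0 [simp]: "trunk 0 v = []"
  by (simp_all add: region_def trunk_def)

lemma region_Suc: "region (Suc n) v = component G (region n v - set (branch n v)) v"
  and trunk_Suc: "trunk (Suc n) v = trim G (region (Suc n) v) (trunk n v @ branch n v)"
  by (simp_all add: region_def trunk_def branch_def case_prod_unfold Let_def)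

lemma region_Suc_subset: "region (Suc n) v \<subseteq> region n v - set (branch n v)"
  unfolding region_Suc by (rule component_subset)

lemma trunk_Suc_prefix:
  obtains cs where "trunk n v @ branch n v = trunk (Suc n) v @ cs"
    "set cs \<inter> nbh G (region (Suc n) v) = {}"
  using trim_prefix[of "trunk n v @ branch n v" G "region (Suc n) v"] that
  unfolding trunk_Suc[symmetric] by blast

lemma region_antimono: "m \<le> n \<Longrightarrow> region n v \<subseteq> region m v"
  by (rule lift_Suc_antimono_le[of "\<lambda>n. region n v"]) (use region_Suc_subset in blast)

text \<open>By induction: the strategy makes the same choice throughout a region, and vertices that stay
  in a common region at the next step lie in the same component.\<close>

lemma state_eq: "w \<in> region n v \<Longrightarrow> state n w = state n v"
proof (induction n)
  case (Suc n)
  then have "w \<in> region n v" using region_Suc_subset by blast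
  then have s: "state n w = state n v" by (rule Suc.IH)
  then have "branch n w = branch n v" "region n w = region n v" "trunk n w = trunk n v"
    by (simp_all add: branch_def region_def trunk_def)
  moreover from this have "region (Suc n) w = region (Suc n) v"
    using component_eq Suc.prems unfolding region_Suc by metis
  ultimately have "trunk (Suc n) w = trunk (Suc n) v"
    by (simp add: trunk_Suc)
  with \<open>region (Suc n) w = region (Suc n) v\<close> show ?case
    by (simp add: region_def trunk_def prod_eq_iff)
qed simp

lemma agree_in_region:
  assumes "w \<in> region n v"
  shows "region n w = region n v" "trunk n w = trunk n v" "branch n w = branch n v"
  using state_eq[OF assms] by (simp_all add: region_def trunk_def branch_def)

definition root :: 'a where "root = hd (ext 0 [] (verts G))"

definition sound :: "nat \<Rightarrow> 'a \<Rightarrow> bool" where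
  "sound n v \<longleftrightarrow> extendable G (trunk n v) (region n v) \<and> nbh G (region n v) \<subseteq> set (trunk n v) \<and>
     distinct (trunk n v) \<and> set (trunk n v) \<subseteq> verts G - region n v \<and>
     path_edges (trunk n v) \<subseteq> edges G \<and> (n > 0 \<longrightarrow> trunk n v \<noteq> [] \<and> hd (trunk n v) = root)"

lemma extension_branch:
  assumes "sound n v"
  shows "is_path G (branch n v)" "set (branch n v) \<subseteq> region n v"
    "trunk n v \<noteq> [] \<Longrightarrow> {last (trunk n v), hd (branch n v)} \<in> edges G" "branch n v \<noteq> []"
proof -
  have "extension G (trunk n v) (region n v) (branch n v)"
    using assms ext by (simp add: sound_def branch_def)
  then show "is_path G (branch n v)" "set (branch n v) \<subseteq> region n v"
    "trunk n v \<noteq> [] \<Longrightarrow> {last (trunk n v), hd (branch n v)} \<in> edges G" "branch n v \<noteq> []"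
    by (auto simp: extension_def is_path_def)
qed

lemma full_path:
  assumes "sound n v"
  shows "is_path G (trunk n v @ branch n v)" "hd (trunk n v @ branch n v) = root"
proof -
  note e = extension_branch[OF assms]
  show "is_path G (trunk n v @ branch n v)"
    using assms e unfolding sound_def is_path_def by (auto simp: path_edges_append)
  show "hd (trunk n v @ branch n v) = root"
  proof (cases n)
    case 0
    then show ?thesis by (simp add: branch_def root_def)
  next
    case (Suc m)
    then show ?thesis using assms by (simp add: sound_def)
  qed
qed

text \<open>The new region has a neighbour, since it is a nonempty proper part of the connected
  graph; hence the trimmed trunk is nonempty and still starts at the root.\<close>

lemma sound_active:
  assumes v: "v \<in> verts G" and "v \<in> region n v"
  shows "sound n v"
  using assms(2)
proof (induction n)
  case 0
  have "nbh G (verts G) = {}" by (auto simp: nbh_def)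
  then show ?case
    using v connected_graph_connected_in[OF conn] by (auto simp: sound_def extendable_def)
next
  case (Suc n)
  then have g: "sound n v" using region_Suc_subset by blast
  note e = extension_branch[OF g] and f = full_path[OF g]
  let ?x = "trunk n v @ branch n v" and ?D = "region (Suc n) v"
  have V: "region n v \<subseteq> verts G" using region_antimono[of 0 n v] by simp
  have nb: "nbh G ?D \<subseteq> set ?x"
    using nbh_component_diff[OF e(2), of G v] g by (auto simp: region_Suc sound_def)
  have cD: "connected_in G ?D" unfolding region_Suc by (rule component_connected)
  have disj: "set ?x \<inter> ?D = {}"
    using region_Suc_subset[of n v] g by (auto simp: sound_def)
  obtain zs where zs: "?x = trunk (Suc n) v @ zs" "set zs \<inter> nbh G ?D = {}"
    by (rule trunk_Suc_prefix)
  have nb': "nbh G ?D \<subseteq> set (trunk (Suc n) v)"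
    using nb zs(2) unfolding zs(1) by auto
  have sub: "set (trunk (Suc n) v) \<subseteq> set ?x" "path_edges (trunk (Suc n) v) \<subseteq> path_edges ?x"
    unfolding zs(1) path_edges_append[of "trunk (Suc n) v" zs] by auto
  have "nbh G ?D \<noteq> {}"
  proof
    assume "nbh G ?D = {}"
    then have "?D = verts G"
      using connected_in_no_boundary[OF connected_graph_connected_in[OF conn] order_refl, of ?D]
        Suc.prems V region_Suc_subset[of n v] by blast
    moreover have "hd (branch n v) \<in> set (branch n v)" "hd (branch n v) \<in> verts G"
      using e(2,4) V hd_in_set by blast+
    ultimately show False using region_Suc_subset[of n v] by blast
  qed
  then have ne: "trunk (Suc n) v \<noteq> []" using nb' by auto
  have hd: "hd (trunk (Suc n) v) = root"
    using f(2) ne unfolding zs(1) by simp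
  have "distinct (trunk (Suc n) v)"
    using f(1) unfolding zs(1) is_path_def by simp
  moreover have "set (trunk (Suc n) v) \<subseteq> verts G - ?D" "path_edges (trunk (Suc n) v) \<subseteq> edges G"
    using sub f(1) disj unfolding is_path_def by blast+
  moreover have "last (trunk (Suc n) v) \<in> nbh G ?D"
    using trim_last ne unfolding trunk_Suc by blast
  moreover have "?D \<subseteq> verts G" "?D \<noteq> {}"
    using V region_Suc_subset[of n v] Suc.prems by blast+
  ultimately show ?case
    using nb' ne hd cD unfolding sound_def extendable_def by blast
qed

definition hit :: "nat \<Rightarrow> 'a \<Rightarrow> bool" where
  "hit n v \<longleftrightarrow> v \<in> region n v \<and> v \<in> set (branch n v)"

lemma hit_unique: "hit m v \<Longrightarrow> hit n v \<Longrightarrow> m = n"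
proof -
  have "False" if "hit m v" "hit n v" "m < n" for m n
  proof -
    have "v \<in> region (Suc m) v" using that region_antimono[of "Suc m" n v] by (auto simp: hit_def)
    then show False using that region_Suc_subset[of m v] by (auto simp: hit_def)
  qed
  then show "hit m v \<Longrightarrow> hit n v \<Longrightarrow> m = n" by (metis nat_neq_iff)
qed

lemma active_if_not_hit: "v \<in> verts G \<Longrightarrow> (\<And>m. m < n \<Longrightarrow> \<not> hit m v) \<Longrightarrow> v \<in> region n v"
proof (induction n)
  case (Suc n)
  then have "v \<in> region n v" "\<not> hit n v" by auto
  then show ?case unfolding region_Suc by (intro component_self) (auto simp: hit_def)
qed simp

definition root_path :: "'a \<Rightarrow> 'a list" where
  "root_path v = (let n = (THE n. hit n v) in takeWhile (\<lambda>w. w \<noteq> v) (trunk n v @ branch n v) @ [v])"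

lemma takeWhile_split: "w \<notin> set ys \<Longrightarrow> takeWhile (\<lambda>x. x \<noteq> w) (ys @ w # zs) = ys"
  by (subst takeWhile_append2) auto

lemma root_path_hit:
  assumes v: "v \<in> verts G" and "hit n v" "trunk n v @ branch n v = ys @ v # zs"
  shows "root_path v = ys @ [v]"
proof -
  have n: "(THE n. hit n v) = n" using assms(2) hit_unique by blast
  have "sound n v" using sound_active v assms(2) by (simp add: hit_def)
  then have "distinct (ys @ v # zs)" using full_path(1) assms(3) by (metis is_path_def)
  then show ?thesis
    unfolding root_path_def n Let_def assms(3) by (simp add: takeWhile_split)
qed

text \<open>A vertex on the current branch lies in the current region and so shares the list
  \<open>trunk n v @ branch n v\<close>; a vertex further down the trunk was on this list one step earlier, as
  trimming only removes a final segment.\<close>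

lemma root_path_prefix:
  assumes "v \<in> verts G" "v \<in> region n v" "trunk n v @ branch n v = ys @ w # zs"
  shows "root_path w = ys @ [w]"
  using assms(2,3)
proof (induction n arbitrary: ys zs)
  case (0 ys zs)
  have "w \<in> set (branch 0 v)" using "0.prems" by simp
  moreover have "sound 0 v" using sound_active assms(1) 0 by blast
  ultimately have w: "w \<in> region 0 v" using extension_branch(2) by blast
  note s = agree_in_region[OF w]
  have "hit 0 w" using w \<open>w \<in> set (branch 0 v)\<close> s unfolding hit_def by simp
  then show ?case using root_path_hit[of w 0] "0.prems" s w by simp
next
  case (Suc n ys zs)
  have g: "sound (Suc n) v" using sound_active assms(1) Suc by blast
  show ?case
  proof (cases "w \<in> set (branch (Suc n) v)")
    case True
    then have w: "w \<in> region (Suc n) v" using extension_branch(2)[OF g] by blast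
    note s = agree_in_region[OF w]
    have "hit (Suc n) w" using w True s unfolding hit_def by simp
    moreover have "w \<in> verts G" using w g by (auto simp: sound_def extendable_def)
    ultimately show ?thesis using root_path_hit[of w "Suc n"] Suc.prems s by simp
  next
    case False
    then have "w \<in> set (trunk (Suc n) v)"
      using Suc.prems(2) by (metis Un_iff in_set_conv_decomp set_append)
    then obtain as bs where p: "trunk (Suc n) v = as @ w # bs" by (meson split_list)
    have "distinct (trunk (Suc n) v @ branch (Suc n) v)"
      using full_path(1)[OF g] by (simp add: is_path_def)
    then have d: "w \<notin> set as" "w \<notin> set ys"
      by (simp add: p) (use \<open>distinct (trunk (Suc n) v @ branch (Suc n) v)\<close> in \<open>simp add: Suc.prems(2)\<close>)
    have "ys = as"
      using takeWhile_split[OF d(2), of zs] takeWhile_split[OF d(1), of "bs @ branch (Suc n) v"]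
        Suc.prems(2) by (simp add: p)
    obtain cs where "trunk n v @ branch n v = trunk (Suc n) v @ cs"
      by (rule trunk_Suc_prefix)
    then have "trunk n v @ branch n v = ys @ w # (bs @ cs)"
      using \<open>ys = as\<close> by (simp add: p)
    moreover have "v \<in> region n v" using Suc.prems region_Suc_subset by blast
    ultimately show ?thesis using Suc.IH by blast
  qed
qed

lemma region_adjacent:
  assumes "u \<in> region n u" "v \<in> region n v" "{u, v} \<in> edges G" "u \<in> verts G" "v \<in> verts G"
  shows "v \<in> region n u"
  using assms(1,2)
proof (induction n)
  case (Suc n)
  then have a: "u \<in> region n u" "v \<in> region n v" using region_Suc_subset by blast+
  then have v: "v \<in> region n u" using Suc.IH by blast
  then have "v \<notin> set (branch n u)" using agree_in_region[OF v] Suc.prems(2) region_Suc_subset[of n v] by auto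
  then show ?case
    using component_closed[of u G "region n u - set (branch n u)" u v] Suc.prems(1) v assms(3)
    unfolding region_Suc by simp
qed (use assms in simp)

text \<open>If \<open>u\<close> is reached strictly before \<open>v\<close>, it is a neighbour of all later regions of \<open>v\<close>
  and therefore never trimmed from their trunks.\<close>

lemma hit_neighbour_on_path:
  assumes "hit m u" "m \<le> n" "v \<in> region n v" "{u, v} \<in> edges G" "u \<in> verts G" "v \<in> verts G"
  shows "u \<in> set (trunk n v @ branch n v)"
proof -
  have u: "u \<in> region m u" "u \<in> set (branch m u)" using assms by (auto simp: hit_def)
  have "v \<in> region m v" using assms region_antimono by blast
  then have v: "v \<in> region m u" using region_adjacent assms u by blast
  show ?thesis
  proof (cases "m = n")
    case True
    then show ?thesis using agree_in_region[OF v] u by simp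
  next
    case False
    have "u \<notin> region (Suc m) v" using region_Suc_subset[of m v] agree_in_region[OF v] u by auto
    then have "u \<notin> region n v" using region_antimono[of "Suc m" n v] False assms(2) by auto
    then have "u \<in> nbh G (region n v)" using assms by (auto simp: nbh_def)
    moreover have "sound n v" using sound_active assms by blast
    ultimately show ?thesis by (auto simp: sound_def)
  qed
qed

lemma root_path_full:
  assumes "v \<in> verts G" "hit n v"
  obtains zs where "trunk n v @ branch n v = root_path v @ zs"
    "is_path_between G root (root_path v) v"
proof -
  obtain ys zs where s: "trunk n v @ branch n v = ys @ v # zs"
    using assms(2) by (metis hit_def in_set_conv_decomp append.assoc)
  have rp: "root_path v = ys @ [v]" using root_path_hit assms s by blast
  have g: "sound n v" using sound_active assms by (simp add: hit_def)
  have e: "trunk n v @ branch n v = root_path v @ zs" using s rp by simp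
  have "is_path G (root_path v)"
    using full_path(1)[OF g] unfolding e is_path_def path_edges_append[of "root_path v" zs]
    by (auto simp: rp)
  moreover have "hd (root_path v) = root" "last (root_path v) = v"
    using full_path(2)[OF g] hd_append2[of "root_path v" zs] unfolding e by (simp_all add: rp)
  ultimately show ?thesis using that e unfolding is_path_between_def by blast
qed


text \<open>The list \<open>trunk n v @ branch n v\<close> contains both vertices, and the root path of each of them is
  an initial segment of it.\<close>

lemma root_paths_comparable:
  assumes "hit m u" "hit n v" "m \<le> n" "{u, v} \<in> edges G" "u \<in> verts G" "v \<in> verts G"
  shows "u \<in> set (root_path v) \<or> v \<in> set (root_path u)"
proof -
  have v: "v \<in> region n v" using assms by (simp add: hit_def)
  obtain zs where zs: "trunk n v @ branch n v = root_path v @ zs"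
    and rv: "is_path_between G root (root_path v) v"
    using root_path_full assms by blast
  have "u \<in> set (root_path v) \<union> set zs"
    using hit_neighbour_on_path[of m u n v] assms v zs by simp
  moreover have ?thesis if "u \<in> set zs"
  proof -
    obtain as bs where "zs = as @ u # bs" using \<open>u \<in> set zs\<close> by (meson split_list)
    then have "trunk n v @ branch n v = (root_path v @ as) @ u # bs" using zs by simp
    then have "root_path u = (root_path v @ as) @ [u]"
      using root_path_prefix assms v by blast
    moreover have "v \<in> set (root_path v)"
      using rv unfolding is_path_between_def is_path_def by (metis last_in_set)
    ultimately show ?thesis by simp
  qed
  ultimately show ?thesis by blast
qed

lemma normal_spanning_tree_if_all_hit:
  assumes "\<And>v. v \<in> verts G \<Longrightarrow> \<exists>n. hit n v"
  shows "\<exists>T. normal_spanning_tree G T root"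
proof (rule normal_spanning_tree_of_root_paths[OF simple])
  have full: "\<exists>n zs. v \<in> region n v \<and> trunk n v @ branch n v = root_path v @ zs \<and>
      is_path_between G root (root_path v) v" if v: "v \<in> verts G" for v
  proof -
    obtain n where n: "hit n v" using assms v by blast
    then obtain zs where "trunk n v @ branch n v = root_path v @ zs"
      "is_path_between G root (root_path v) v"
      using root_path_full v by blast
    then show ?thesis using n unfolding hit_def by blast
  qed
  then show rp: "is_path_between G root (root_path v) v" if "v \<in> verts G" for v
    using that by blast
  obtain v where "v \<in> verts G" using conn by (auto simp: connected_graph_def)
  then have "is_path_between G root (root_path v) v" by (rule rp)
  then show "root \<in> verts G"
    unfolding is_path_between_def is_path_def by (metis hd_in_set subsetD)
  show "root_path w = ys @ [w]" if v: "v \<in> verts G" and e: "root_path v = ys @ w # zs" for v w ys zs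
  proof -
    obtain n zs' where n: "v \<in> region n v" "trunk n v @ branch n v = root_path v @ zs'"
      using full[OF v] by blast
    then have "trunk n v @ branch n v = ys @ w # (zs @ zs')" using e by simp
    then show ?thesis using root_path_prefix v n(1) by blast
  qed
  show "u \<in> set (root_path v) \<or> v \<in> set (root_path u)" if uv: "{u, v} \<in> edges G" for u v
  proof -
    have V: "u \<in> verts G" "v \<in> verts G"
      using simple uv unfolding simple_graph_def by (fastforce simp: doubleton_eq_iff)+
    then obtain m n where "hit m u" "hit n v" using assms by blast
    moreover have "{v, u} \<in> edges G" using uv by (simp add: insert_commute)
    ultimately show ?thesis
      using root_paths_comparable uv V by (metis nat_le_linear)
  qed
qed

definition limit :: "'a \<Rightarrow> 'a set" where
  "limit v = component G (\<Inter>n. region n v) v"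

text \<open>If \<open>v\<close> is never reached, a neighbour of the limit must drop out of the regions of \<open>v\<close> at some
  step, and from then on it is a neighbour of every region of \<open>v\<close>. Were there only finitely many
  neighbours, one step would serve for all of them, and the limit would be the region of that step.
  The position of a neighbour on the trunk is fixed because trunks change only behind it.\<close>

lemma limit_neighbourhood:
  assumes v: "v \<in> verts G" and never: "\<And>n. \<not> hit n v"
  shows "v \<in> limit v" "limit v \<subseteq> region n v" "connected_in G (limit v)" "infinite (nbh G (limit v))"
    and "u \<in> nbh G (limit v) \<Longrightarrow> \<exists>i m. \<forall>n\<ge>m. i < length (trunk n v) \<and> trunk n v ! i = u"
proof -
  have act: "v \<in> region n v" for n using active_if_not_hit v never by blast
  have g: "sound n v" for n using sound_active v act by blast
  show vl: "v \<in> limit v" unfolding limit_def using act by (intro component_self) blast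
  have sub: "limit v \<subseteq> region n v" for n
    using component_subset[of G "\<Inter>n. region n v" v] unfolding limit_def by blast
  then show "limit v \<subseteq> region n v" .
  show cl: "connected_in G (limit v)" unfolding limit_def by (rule component_connected)
  have leave: "\<exists>m. \<forall>n\<ge>m. u \<notin> region n v \<and> u \<in> set (trunk n v)" if u: "u \<in> nbh G (limit v)" for u
  proof -
    obtain d where d: "d \<in> limit v" "{u, d} \<in> edges G" "u \<notin> limit v" "u \<in> verts G"
      using u by (auto simp: nbh_def)
    have "u \<notin> (\<Inter>n. region n v)"
      using component_closed[of d G "\<Inter>n. region n v" v u] d unfolding limit_def
      by (auto simp: insert_commute)
    then obtain m where "u \<notin> region m v" by blast
    then have out: "u \<notin> region n v" if "n \<ge> m" for n
      using that region_antimono by blast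
    moreover have "u \<in> set (trunk n v)" if "n \<ge> m" for n
    proof -
      have "d \<in> region n v" using d(1) sub by blast
      then have "u \<in> nbh G (region n v)" using d out[OF that] unfolding nbh_def by blast
      then show ?thesis using g[of n] unfolding sound_def by blast
    qed
    ultimately show ?thesis by blast
  qed
  show "infinite (nbh G (limit v))"
  proof
    assume fin: "finite (nbh G (limit v))"
    have "\<exists>M. \<forall>u\<in>F. u \<notin> region M v" if "finite F" "F \<subseteq> nbh G (limit v)" for F
      using that
    proof (induction F)
      case (insert u F)
      then obtain M where M: "\<forall>u\<in>F. u \<notin> region M v" by blast
      obtain m where m: "u \<notin> region m v" using leave insert.prems by blast
      have "\<forall>u'\<in>insert u F. u' \<notin> region (max M m) v"
        using M m region_antimono[of M "max M m" v] region_antimono[of m "max M m" v] by auto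
      then show ?case by blast
    qed simp
    from this[OF fin order_refl] obtain M where "nbh G (limit v) \<inter> region M v = {}" by blast
    then have "limit v = region M v"
      using connected_in_no_boundary[of G "region M v" "limit v"] g[of M] sub[of M] vl
      unfolding sound_def extendable_def by blast
    then show False
      using sub[of "Suc M"] region_Suc_subset[of M v] extension_branch(2,4)[OF g[of M]]
      by (metis Diff_iff hd_in_set subsetD)
  qed
  show "\<exists>i m. \<forall>n\<ge>m. i < length (trunk n v) \<and> trunk n v ! i = u" if u: "u \<in> nbh G (limit v)"
  proof -
    obtain m where m: "\<And>n. n \<ge> m \<Longrightarrow> u \<in> set (trunk n v)" using leave[OF u] by blast
    then obtain i where i: "i < length (trunk m v)" "trunk m v ! i = u"
      by (metis in_set_conv_nth order_refl)
    have "i < length (trunk n v) \<and> trunk n v ! i = u" if "n \<ge> m" for n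
      using that
    proof (induction n rule: dec_induct)
      case base
      then show ?case using i by simp
    next
      case (step n)
      have "u \<in> set (trunk (Suc n) v)" using m step.hyps by simp
      then obtain j where j: "j < length (trunk (Suc n) v)" "trunk (Suc n) v ! j = u"
        by (metis in_set_conv_nth)
      obtain cs where cs: "trunk n v @ branch n v = trunk (Suc n) v @ cs"
        by (rule trunk_Suc_prefix)
      have "(trunk n v @ branch n v) ! j = u" unfolding cs using j by (simp add: nth_append)
      moreover have "(trunk n v @ branch n v) ! i = u" using step.IH by (simp add: nth_append)
      moreover have "distinct (trunk n v @ branch n v)"
        using full_path(1)[OF g] by (simp add: is_path_def)
      moreover have "j < length (trunk n v @ branch n v)" unfolding cs using j by simp
      moreover have "i < length (trunk n v @ branch n v)" using step.IH by simp
      ultimately have "i = j" by (metis nth_eq_iff_index_eq)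
      then show ?case using j by simp
    qed
    then show ?thesis by blast
  qed
qed

end


section \<open>Uncountably linked pairs and fat subdivisions\<close>

text \<open>The bound on the length excludes a path that consists of a single edge, which can serve
  only one of the parallel edges of a fat \<open>K\<close>.\<close>

definition uncountably_linked :: "'a graph \<Rightarrow> 'a \<Rightarrow> 'a \<Rightarrow> bool" where
  "uncountably_linked G u v \<longleftrightarrow>
     (\<forall>S. countable S \<longrightarrow>
        (\<exists>xs. is_path_between G u xs v \<and> length xs \<ge> 3 \<and> path_interior xs \<inter> S = {}))"

lemma path_interior_nonempty:
  assumes "distinct xs" "length xs \<ge> 3"
  shows "path_interior xs \<noteq> {}"
proof -
  obtain x y z zs where xs: "xs = x # y # z # zs"
    using assms(2) by (metis Suc_le_length_iff numeral_3_eq_3)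
  have "y \<in> path_interior xs"
    using assms(1) by (auto simp: path_interior_def xs)
  then show ?thesis by blast
qed

lemma path_edge_meets_interior:
  assumes "distinct xs" "length xs \<ge> 3" "e \<in> path_edges xs"
  shows "e \<inter> path_interior xs \<noteq> {}"
proof -
  obtain i where i: "Suc i < length xs" "e = {xs ! i, xs ! Suc i}"
    using assms(3) by (auto simp: path_edges_def)
  have ne: "xs \<noteq> []" using i by auto
  have int: "xs ! j \<in> path_interior xs" if "0 < j" "Suc j < length xs" for j
  proof -
    have "xs ! j \<noteq> xs ! 0" "xs ! j \<noteq> xs ! (length xs - 1)"
      using that assms(1) ne by (auto simp: nth_eq_iff_index_eq)
    then show ?thesis
      using that ne by (simp add: path_interior_def hd_conv_nth last_conv_nth)
  qed
  show ?thesis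
  proof (cases i)
    case 0
    then have "xs ! Suc i \<in> path_interior xs" using assms(2) by (intro int) auto
    then show ?thesis using i(2) by blast
  next
    case (Suc j)
    then have "xs ! i \<in> path_interior xs" using i(1) by (intro int) auto
    then show ?thesis using i(2) by blast
  qed
qed

lemma maximal_disjoint_family:
  fixes I :: "'b \<Rightarrow> 'c set"
  obtains F where "F \<subseteq> X" "\<And>R R'. R \<in> F \<Longrightarrow> R' \<in> F \<Longrightarrow> R \<noteq> R' \<Longrightarrow> I R \<inter> I R' = {}"
    "\<And>R. R \<in> X \<Longrightarrow> R \<notin> F \<Longrightarrow> \<exists>R'\<in>F. I R \<inter> I R' \<noteq> {}"
proof -
  define A where "A = {F. F \<subseteq> X \<and> (\<forall>R\<in>F. \<forall>R'\<in>F. R \<noteq> R' \<longrightarrow> I R \<inter> I R' = {})}"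
  have "\<Union>C \<in> A" if C: "C \<in> chains A" for C
  proof -
    have "I R \<inter> I R' = {}" if R: "R \<in> \<Union>C" "R' \<in> \<Union>C" "R \<noteq> R'" for R R'
    proof -
      obtain F F' where F: "F \<in> C" "R \<in> F" "F' \<in> C" "R' \<in> F'" using R by blast
      then have "F \<subseteq> F' \<or> F' \<subseteq> F" using C chainsD by blast
      then obtain K where "K \<in> C" "R \<in> K" "R' \<in> K" using F by blast
      moreover have "K \<in> A" using C chainsD2 \<open>K \<in> C\<close> by blast
      ultimately show ?thesis using R(3) by (simp add: A_def)
    qed
    moreover have "\<Union>C \<subseteq> X" using C chainsD2 unfolding A_def by blast
    ultimately show ?thesis by (simp add: A_def)
  qed
  then obtain F where F: "F \<in> A" "\<forall>K\<in>A. F \<subseteq> K \<longrightarrow> K = F"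
    using Zorn_Lemma[of A] by blast
  have "\<exists>R'\<in>F. I R \<inter> I R' \<noteq> {}" if R: "R \<in> X" "R \<notin> F" for R
  proof (rule ccontr)
    assume "\<not> ?thesis"
    then have "\<forall>R'\<in>F. I R \<inter> I R' = {} \<and> I R' \<inter> I R = {}" by blast
    then have "insert R F \<in> A" using F(1) R(1) by (simp add: A_def)
    then show False using F(2) R(2) by blast
  qed
  then show ?thesis using that[of F] F(1) unfolding A_def by blast
qed

text \<open>One path for each pair of an enumeration, with pairwise disjoint interiors. Collecting
  whole rounds instead of single paths ensures that no pair is neglected when a maximal family is chosen.\<close>

definition path_round :: "'a graph \<Rightarrow> 'a set \<Rightarrow> (nat \<Rightarrow> 'a \<times> 'a) \<Rightarrow> (nat \<Rightarrow> 'a list) \<Rightarrow> bool" where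
  "path_round G U pr R \<longleftrightarrow>
     (\<forall>k. is_path_between G (fst (pr k)) (R k) (snd (pr k)) \<and> length (R k) \<ge> 3 \<and>
        path_interior (R k) \<inter> U = {}) \<and>
     (\<forall>k l. k \<noteq> l \<longrightarrow> path_interior (R k) \<inter> path_interior (R l) = {})"

text \<open>The paths are chosen one after another; only countably many vertices have to be avoided
  at each choice.\<close>

lemma round_avoiding_countable:
  assumes linked: "\<And>k. uncountably_linked G (fst (pr k)) (snd (pr k))"
    and "countable U" "countable S"
  obtains R where "path_round G U pr R" "\<And>k. path_interior (R k) \<inter> S = {}"
proof -
  define g where "g W k = (SOME xs. is_path_between G (fst (pr k)) xs (snd (pr k)) \<and>
    length xs \<ge> 3 \<and> path_interior xs \<inter> W = {})" for W k
  have g: "is_path_between G (fst (pr k)) (g W k) (snd (pr k)) \<and>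
      length (g W k) \<ge> 3 \<and> path_interior (g W k) \<inter> W = {}" if "countable W" for W k
    unfolding g_def by (rule someI_ex) (use linked[of k] that in \<open>simp add: uncountably_linked_def\<close>)
  define used where "used = rec_nat (S \<union> U) (\<lambda>k W. W \<union> set (g W k))"
  have used: "used 0 = S \<union> U" "used (Suc k) = used k \<union> set (g (used k) k)" for k
    by (simp_all add: used_def)
  have cnt: "countable (used k)" for k
    using assms by (induction k) (simp_all add: used countable_finite)
  define R where "R k = g (used k) k" for k
  have R: "is_path_between G (fst (pr k)) (R k) (snd (pr k))" "length (R k) \<ge> 3"
    "path_interior (R k) \<inter> used k = {}" for k
    using g[OF cnt] unfolding R_def by blast+
  have mono: "used k \<subseteq> used l" if "k \<le> l" for k l
    by (rule lift_Suc_mono_le[OF _ that]) (simp add: used)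
  have disj: "path_interior (R k) \<inter> path_interior (R l) = {}" if "k < l" for k l
  proof -
    have "path_interior (R k) \<subseteq> used (Suc k)"
      by (auto simp: used R_def path_interior_def)
    also have "\<dots> \<subseteq> used l" using that by (intro mono) simp
    finally show ?thesis using R(3)[of l] by blast
  qed
  have "path_interior (R k) \<inter> path_interior (R l) = {}" if "k \<noteq> l" for k l
    using disj[of k l] disj[of l k] that by (cases "k < l") (auto simp: Int_commute)
  moreover have "path_interior (R k) \<inter> (S \<union> U) = {}" for k
    using R(3)[of k] mono[of 0 k] by (auto simp: used)
  ultimately show ?thesis using that[of R] R by (auto simp: path_round_def)
qed

text \<open>The vertices used by a countable family of rounds form a countable set, and a further round
  avoids it; so a maximal family of disjoint rounds is uncountable.\<close>

lemma uncountable_disjoint_rounds: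
  assumes linked: "\<And>k. uncountably_linked G (fst (pr k)) (snd (pr k))" and U: "countable U"
  obtains F where "uncountable F" "\<And>R. R \<in> F \<Longrightarrow> path_round G U pr R"
    "\<And>R R' k l. R \<in> F \<Longrightarrow> R' \<in> F \<Longrightarrow> R \<noteq> R' \<Longrightarrow> path_interior (R k) \<inter> path_interior (R' l) = {}"
proof -
  let ?I = "\<lambda>R. \<Union>k. path_interior (R k)"
  obtain F where F: "F \<subseteq> {R. path_round G U pr R}"
    "\<And>R R'. R \<in> F \<Longrightarrow> R' \<in> F \<Longrightarrow> R \<noteq> R' \<Longrightarrow> ?I R \<inter> ?I R' = {}"
    "\<And>R. R \<in> {R. path_round G U pr R} \<Longrightarrow> R \<notin> F \<Longrightarrow> \<exists>R'\<in>F. ?I R \<inter> ?I R' \<noteq> {}"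
    using maximal_disjoint_family[of "{R. path_round G U pr R}" ?I] by metis
  have "uncountable F"
  proof
    assume "countable F"
    moreover have "countable (?I R)" for R :: "nat \<Rightarrow> 'a list"
      by (intro countable_UN) (auto simp: path_interior_def countable_finite)
    ultimately have "countable (\<Union>R\<in>F. ?I R)" using countable_UN[of F ?I] by simp
    then obtain R where R: "path_round G U pr R" "\<And>k. path_interior (R k) \<inter> (\<Union>R\<in>F. ?I R) = {}"
      by (rule round_avoiding_countable[of G pr U, OF linked U]) blast
    have "R \<notin> F"
    proof
      assume "R \<in> F"
      then have "path_interior (R 0) = {}" using R(2)[of 0] by blast
      moreover have "distinct (R 0)" "length (R 0) \<ge> 3"
        using R(1) by (auto simp: path_round_def is_path_between_def is_path_def)
      ultimately show False using path_interior_nonempty by blast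
    qed
    then obtain R' where "R' \<in> F" "?I R \<inter> ?I R' \<noteq> {}" using F(3) R(1) by blast
    then show False using R(2) by blast
  qed
  moreover have "path_round G U pr R" if "R \<in> F" for R using that F(1) by blast
  moreover have "path_interior (R k) \<inter> path_interior (R' l) = {}"
    if "R \<in> F" "R' \<in> F" "R \<noteq> R'" for R R' k l
    using F(2)[OF that] by blast
  ultimately show ?thesis by (rule that)
qed

text \<open>An edge of a path with an interior vertex has an interior vertex as an end, and this end
  would also lie on the second path.\<close>

lemma path_edges_disjoint:
  assumes "distinct xs" "length xs \<ge> 3" "path_interior xs \<inter> path_interior ys = {}"
    "path_interior xs \<inter> {hd ys, last ys} = {}"
  shows "path_edges xs \<inter> path_edges ys = {}"
proof (rule ccontr)
  assume "\<not> ?thesis"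
  then obtain e where e: "e \<in> path_edges xs" "e \<in> path_edges ys" by blast
  obtain w where "w \<in> e" "w \<in> path_interior xs"
    using path_edge_meets_interior[OF assms(1,2) e(1)] by blast
  moreover have "w \<in> set ys" using path_edges_subset[OF e(2)] \<open>w \<in> e\<close> by blast
  ultimately show False using assms(3,4) unfolding path_interior_def by blast
qed

text \<open>The paths themselves serve as the edges of the fat \<open>K\<close>.\<close>

lemma fat_TK_of_path_family:
  fixes G :: "'a graph" and P :: "'a list set"
  assumes U: "countable U" "infinite U" "U \<subseteq> verts G"
    and P: "\<And>xs. xs \<in> P \<Longrightarrow> is_path G xs \<and> length xs \<ge> 3 \<and> hd xs \<in> U \<and> last xs \<in> U \<and>
      path_interior xs \<inter> U = {}"
    and disj: "\<And>xs ys. xs \<in> P \<Longrightarrow> ys \<in> P \<Longrightarrow> xs \<noteq> ys \<Longrightarrow> path_interior xs \<inter> path_interior ys = {}"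
    and unc: "\<And>u v. u \<in> U \<Longrightarrow> v \<in> U \<Longrightarrow> u \<noteq> v \<Longrightarrow> uncountable {xs \<in> P. {hd xs, last xs} = {u, v}}"
  shows "\<exists>H. subgraph H G \<and> fat_TK_aleph0 H"
proof -
  define M :: "('a, 'a list) multigraph"
    where "M = \<lparr>mverts = U, medges = P, mends = (\<lambda>xs. {hd xs, last xs})\<rparr>"
  define H where "H = \<lparr>verts = U \<union> (\<Union>xs\<in>P. set xs), edges = (\<Union>xs\<in>P. path_edges xs)\<rparr>"
  have ends: "hd xs \<noteq> last xs" if "xs \<in> P" for xs
  proof -
    have "distinct xs" "length xs \<ge> 3" using P that by (auto simp: is_path_def)
    then show ?thesis by (cases xs) auto
  qed
  have "loopless_multigraph M"
    unfolding loopless_multigraph_def M_def using P ends by simp blast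
  then have fat: "fat_K_aleph0 M"
    unfolding fat_K_aleph0_def using U unc by (simp add: M_def)
  have pathH: "is_path H xs" if "xs \<in> P" for xs
    using P[OF that] that by (auto simp: is_path_def H_def)
  have pedge: "path_edges xs \<inter> path_edges ys = {}" if "xs \<in> P" "ys \<in> P" "xs \<noteq> ys" for xs ys
    using P[OF that(1)] P[OF that(2)] disj[OF that]
    by (intro path_edges_disjoint) (auto simp: is_path_def)
  have "subdivision M H"
    unfolding subdivision_def
  proof (intro exI conjI)
    let ?f = "\<lambda>x :: 'a. x" and ?p = "\<lambda>xs :: 'a list. xs"
    show "inj_on ?f (mverts M)" by simp
    show "\<forall>e\<in>medges M. is_path H (?p e) \<and> {hd (?p e), last (?p e)} = ?f ` mends M e \<and>
        path_interior (?p e) \<inter> ?f ` mverts M = {}"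
      using pathH P by (simp add: M_def)
    show "\<forall>e\<in>medges M. \<forall>e'\<in>medges M. e \<noteq> e' \<longrightarrow>
        path_interior (?p e) \<inter> path_interior (?p e') = {} \<and>
        path_edges (?p e) \<inter> path_edges (?p e') = {}"
      using disj pedge by (simp add: M_def)
  qed (simp_all add: M_def H_def)
  then have "fat_TK_aleph0 H" using fat by (auto simp: fat_TK_aleph0_def)
  moreover have "subgraph H G"
    unfolding subgraph_def
  proof (intro conjI)
    show "verts H \<subseteq> verts G" "edges H \<subseteq> edges G"
      using U(3) P by (fastforce simp: H_def is_path_def)+
    show "simple_graph H"
      unfolding simple_graph_def
    proof
      fix e assume "e \<in> edges H"
      then obtain xs where xs: "xs \<in> P" "e \<in> path_edges xs" by (auto simp: H_def)
      then obtain i where i: "Suc i < length xs" "e = {xs ! i, xs ! Suc i}"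
        by (auto simp: path_edges_def)
      have "distinct xs" "set xs \<subseteq> verts H"
        using P xs(1) by (auto simp: is_path_def H_def)
      then have "xs ! i \<in> verts H" "xs ! Suc i \<in> verts H" "xs ! i \<noteq> xs ! Suc i"
        using i(1) by (auto simp: nth_eq_iff_index_eq)
      then show "\<exists>u v. u \<in> verts H \<and> v \<in> verts H \<and> u \<noteq> v \<and> e = {u, v}"
        using i(2) by blast
    qed
  qed
  ultimately show ?thesis by blast
qed

lemma fat_TK_if_pairwise_uncountably_linked:
  assumes "infinite N" "N \<subseteq> verts G"
    and linked: "\<And>u v. u \<in> N \<Longrightarrow> v \<in> N \<Longrightarrow> u \<noteq> v \<Longrightarrow> uncountably_linked G u v"
  shows "\<exists>H. subgraph H G \<and> fat_TK_aleph0 H"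
proof -
  obtain U where U: "U \<subseteq> N" "countable U" "infinite U"
    using infinite_countable_subset'[OF assms(1)] by blast
  define Q where "Q = {(u, v). u \<in> U \<and> v \<in> U \<and> u \<noteq> v}"
  have "Q \<subseteq> U \<times> U" by (auto simp: Q_def)
  then have Qc: "countable Q" using U(2) countable_subset countable_SIGMA by metis
  obtain a where a: "a \<in> U" using U(3) by fastforce
  obtain b where "b \<in> U - {a}" using U(3) by (metis finite.emptyI infinite_remove ex_in_conv)
  then have Qne: "Q \<noteq> {}" using a by (auto simp: Q_def)
  define pr where "pr = from_nat_into Q"
  have range: "range pr = Q" using Qne Qc by (simp add: pr_def range_from_nat_into)
  have prQ: "fst (pr k) \<in> U" "snd (pr k) \<in> U" "fst (pr k) \<noteq> snd (pr k)" for k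
  proof -
    have "pr k \<in> Q" using range by blast
    then show "fst (pr k) \<in> U" "snd (pr k) \<in> U" "fst (pr k) \<noteq> snd (pr k)"
      by (auto simp: Q_def)
  qed
  have "uncountably_linked G (fst (pr k)) (snd (pr k))" for k
    using prQ U(1) by (intro linked) auto
  then obtain F where F: "uncountable F" "\<And>R. R \<in> F \<Longrightarrow> path_round G U pr R"
    "\<And>R R' k l. R \<in> F \<Longrightarrow> R' \<in> F \<Longrightarrow> R \<noteq> R' \<Longrightarrow> path_interior (R k) \<inter> path_interior (R' l) = {}"
    using uncountable_disjoint_rounds[OF _ U(2)] by metis
  define P where "P = {R k | R k. R \<in> F}"
  have path: "is_path_between G (fst (pr k)) (R k) (snd (pr k))" "length (R k) \<ge> 3"
    "path_interior (R k) \<inter> U = {}" if "R \<in> F" for R k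
    using F(2)[OF that] by (auto simp: path_round_def)
  show ?thesis
  proof (rule fat_TK_of_path_family[OF U(2,3)])
    show "U \<subseteq> verts G" using U(1) assms(2) by blast
    show "is_path G xs \<and> length xs \<ge> 3 \<and> hd xs \<in> U \<and> last xs \<in> U \<and> path_interior xs \<inter> U = {}"
      if xs: "xs \<in> P" for xs
    proof -
      obtain R k where "R \<in> F" "xs = R k" using xs by (auto simp: P_def)
      then show ?thesis using path[of R k] prQ[of k] by (simp add: is_path_between_def)
    qed
    show "path_interior xs \<inter> path_interior ys = {}" if "xs \<in> P" "ys \<in> P" "xs \<noteq> ys" for xs ys
    proof -
      obtain R k where R: "R \<in> F" "xs = R k" using \<open>xs \<in> P\<close> by (auto simp: P_def)
      obtain R' l where R': "R' \<in> F" "ys = R' l" using \<open>ys \<in> P\<close> by (auto simp: P_def)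
      show ?thesis
      proof (cases "R = R'")
        case True
        then have "k \<noteq> l" using R R' \<open>xs \<noteq> ys\<close> by blast
        then show ?thesis using F(2)[OF R(1)] R R' True by (auto simp: path_round_def)
      qed (use F(3) R R' in blast)
    qed
    show "uncountable {xs \<in> P. {hd xs, last xs} = {u, v}}" if uv: "u \<in> U" "v \<in> U" "u \<noteq> v" for u v
    proof
      assume c: "countable {xs \<in> P. {hd xs, last xs} = {u, v}}"
      have "(u, v) \<in> range pr" using uv range by (simp add: Q_def)
      then obtain k where k: "pr k = (u, v)" by (metis rangeE)
      have "(\<lambda>R. R k) ` F \<subseteq> {xs \<in> P. {hd xs, last xs} = {u, v}}"
      proof
        fix xs assume "xs \<in> (\<lambda>R. R k) ` F"
        then obtain R where R: "R \<in> F" "xs = R k" by blast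
        then have "hd xs = u" "last xs = v"
          using path(1)[of R k] k by (simp_all add: is_path_between_def)
        then show "xs \<in> {xs \<in> P. {hd xs, last xs} = {u, v}}" using R by (auto simp: P_def)
      qed
      then have "countable ((\<lambda>R. R k) ` F)" using c countable_subset by blast
      moreover have "inj_on (\<lambda>R. R k) F"
      proof (rule inj_onI, rule ccontr)
        fix R R' assume R: "R \<in> F" "R' \<in> F" "R k = R' k" "R \<noteq> R'"
        then have "path_interior (R k) = {}" using F(3)[of R R' k k] by simp
        moreover have "distinct (R k)"
          using path(1)[OF R(1)] by (auto simp: is_path_between_def is_path_def)
        ultimately show False using path_interior_nonempty path(2)[OF R(1)] by blast
      qed
      ultimately show False using F(1) countable_image_inj_on by blast
    qed
  qed
qed

section \<open>Chasing separators\<close>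

definition separator :: "'a graph \<Rightarrow> 'a \<Rightarrow> 'a \<Rightarrow> 'a set" where
  "separator G u v = (SOME S. countable S \<and>
     (\<forall>xs. is_path_between G u xs v \<longrightarrow> length xs \<ge> 3 \<longrightarrow> path_interior xs \<inter> S \<noteq> {}))"

lemma separator:
  assumes "\<not> uncountably_linked G u v"
  shows "countable (separator G u v)"
    and "is_path_between G u xs v \<Longrightarrow> length xs \<ge> 3 \<Longrightarrow> path_interior xs \<inter> separator G u v \<noteq> {}"
proof -
  let ?P = "\<lambda>S. countable S \<and>
     (\<forall>xs. is_path_between G u xs v \<longrightarrow> length xs \<ge> 3 \<longrightarrow> path_interior xs \<inter> S \<noteq> {})"
  have "\<exists>S. ?P S" using assms unfolding uncountably_linked_def by blast
  then have "?P (separator G u v)" unfolding separator_def by (rule someI_ex)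
  then show "countable (separator G u v)"
    and "is_path_between G u xs v \<Longrightarrow> length xs \<ge> 3 \<Longrightarrow> path_interior xs \<inter> separator G u v \<noteq> {}"
    by blast+
qed

text \<open>For indices beyond the trunk, linked pairs and empty separators the target is an arbitrary vertex;
  reaching it does no harm. The last component of the code gives every triple infinitely many
  turns.\<close>

definition target :: "'a graph \<Rightarrow> nat \<Rightarrow> 'a list \<Rightarrow> 'a" where
  "target G n p =
     (let (i, n') = prod_decode n; (j, n'') = prod_decode n'; (k, _) = prod_decode n''
      in from_nat_into (separator G (p ! i) (p ! j)) k)"

lemma target_recurs:
  "\<exists>n\<ge>m. \<forall>p. target G n p = from_nat_into (separator G (p ! i) (p ! j)) k"
proof (intro exI conjI allI)
  let ?n = "prod_encode (i, prod_encode (j, prod_encode (k, m)))"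
  show "?n \<ge> m"
    by (meson le_prod_encode_2 order_trans)
  show "target G ?n p = from_nat_into (separator G (p ! i) (p ! j)) k" for p
    by (simp add: target_def)
qed

lemma path_through_connected_set:
  assumes "connected_in G C" "C \<subseteq> verts G" "u \<in> nbh G C" "w \<in> nbh G C" "u \<noteq> w"
  obtains xs where "is_path_between G u xs w" "length xs \<ge> 3" "path_interior xs \<subseteq> C"
proof -
  obtain a b where ab: "a \<in> C" "{u, a} \<in> edges G" "b \<in> C" "{w, b} \<in> edges G"
    and uw: "u \<in> verts G" "w \<in> verts G" "u \<notin> C" "w \<notin> C"
    using assms(3,4) by (auto simp: nbh_def)
  obtain ys where ys: "is_path_between G a ys b" "set ys \<subseteq> C"
    using connected_in_path[OF assms(1,2) ab(1,3)] by blast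
  then have y: "ys \<noteq> []" "distinct ys" "path_edges ys \<subseteq> edges G" "hd ys = a" "last ys = b"
    by (auto simp: is_path_between_def is_path_def)
  have "path_edges ([u] @ ys @ [w]) \<subseteq> edges G"
    using y ab(2,4) unfolding path_edges_append by (simp add: insert_commute)
  moreover have "distinct ([u] @ ys @ [w])" "set ([u] @ ys @ [w]) \<subseteq> verts G"
    using y ys(2) uw assms(2,5) by auto
  ultimately have "is_path_between G u ([u] @ ys @ [w]) w"
    by (simp add: is_path_between_def is_path_def)
  moreover have "length ([u] @ ys @ [w]) \<ge> 3" using y(1) by (cases ys) auto
  moreover have "path_interior ([u] @ ys @ [w]) \<subseteq> C" using ys(2) by (auto simp: path_interior_def)
  ultimately show ?thesis by (rule that)
qed

context branching
begin

text \<open>A path through the limit meets the separator in a vertex \<open>s\<close> of the limit. Once both neighbours have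
  their final positions on the trunk, \<open>s\<close> becomes the target and is put on a branch, although the limit
  stays inside all later regions.\<close>

lemma limit_neighbours_linked:
  assumes target: "\<And>n p D. extendable G p D \<Longrightarrow> target G n p \<in> D \<Longrightarrow> target G n p \<in> set (ext n p D)"
    and v: "v \<in> verts G" and never: "\<And>n. \<not> hit n v"
    and uw: "u \<in> nbh G (limit v)" "w \<in> nbh G (limit v)" "u \<noteq> w"
  shows "uncountably_linked G u w"
proof (rule ccontr)
  assume nl: "\<not> uncountably_linked G u w"
  note l = limit_neighbourhood[OF v never]
  have "limit v \<subseteq> verts G" using l(2)[of 0] by simp
  from path_through_connected_set[OF l(3) this uw]
  obtain xs where "is_path_between G u xs w" "length xs \<ge> 3" "path_interior xs \<subseteq> limit v"
    by blast
  then obtain s where s: "s \<in> separator G u w" "s \<in> limit v"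
    using separator(2)[OF nl] by blast
  then obtain k where k: "from_nat_into (separator G u w) k = s"
    using from_nat_into_surj[OF separator(1)[OF nl]] by blast
  obtain i m where i: "\<And>n. n \<ge> m \<Longrightarrow> trunk n v ! i = u" using l(5)[OF uw(1)] by blast
  obtain j m' where j: "\<And>n. n \<ge> m' \<Longrightarrow> trunk n v ! j = w" using l(5)[OF uw(2)] by blast
  obtain n where n: "n \<ge> max m m'"
    "\<And>p. target G n p = from_nat_into (separator G (p ! i) (p ! j)) k"
    using target_recurs by metis
  have t: "target G n (trunk n v) = s" using n i j k by simp
  have "v \<in> region n v" using l(1,2) by blast
  then have "extendable G (trunk n v) (region n v)" using sound_active v by (simp add: sound_def)
  moreover have "s \<in> region n v" using s(2) l(2) by blast
  ultimately have "s \<in> set (branch n v)" using target t unfolding branch_def by metis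
  moreover have "s \<in> region (Suc n) v" using s(2) l(2) by blast
  ultimately show False using region_Suc_subset by blast
qed

end

theorem theorem6p1:
  fixes G :: "'a graph"
  assumes "simple_graph G"
    and "connected_graph G"
    and "\<not> (\<exists>H. subgraph H G \<and> fat_TK_aleph0 H)"
  shows "\<exists>T r. normal_spanning_tree G T r"
proof -
  define ext where
    "ext n p D = (SOME q. extension G p D q \<and> (target G n p \<in> D \<longrightarrow> target G n p \<in> set q))" for n p D
  have strategy: "extension G p D (ext n p D) \<and> (target G n p \<in> D \<longrightarrow> target G n p \<in> set (ext n p D))"
    if "extendable G p D" for n p D
    unfolding ext_def by (rule someI_ex) (rule extension_exists[OF that])
  interpret branching G ext
    using assms(1,2) strategy by unfold_locales blast+
  have "\<exists>n. hit n v" if v: "v \<in> verts G" for v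
  proof (rule ccontr)
    assume "\<not> (\<exists>n. hit n v)"
    then have never: "\<And>n. \<not> hit n v" by blast
    have "nbh G (limit v) \<subseteq> verts G" by (auto simp: nbh_def)
    moreover have "uncountably_linked G u w"
      if "u \<in> nbh G (limit v)" "w \<in> nbh G (limit v)" "u \<noteq> w" for u w
      using strategy by (intro limit_neighbours_linked[OF _ v never that]) blast
    ultimately have "\<exists>H. subgraph H G \<and> fat_TK_aleph0 H"
      using limit_neighbourhood(4)[OF v never] fat_TK_if_pairwise_uncountably_linked by blast
    then show False using assms(3) by blast
  qed
  then show ?thesis using normal_spanning_tree_if_all_hit by blast
qed

end
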